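(* Let $S$ and $\gamma_1,\gamma_2,\gamma_3$ be as in the context. The set $S$ is connected in the standard topology of $\mathbb{R}^3$ and is bounded by the union $\Gamma_1\cup\Gamma_2\cup\Gamma_3$ of pairwise disjoint conic surfaces $$\Gamma_i:=\{(x_1,x_2,x_3)\in(0,+\infty)^3 : \gamma_i=(x_j-x_k)^2+2x_i(x_j+x_k)-3x_i^2=0\}$$ in $\mathbb{R}^3$, where $\{i,j,k\}=\{1,2,3\}$.
   Context: For $\{i,j,k\}=\{1,2,3\}$ put $\gamma_i=(x_j-x_k)^2+2x_i(x_j+x_k)-3x_i^2$, and $$S=\{(x_1,x_2,x_3)\in(0,+\infty)^3 : \gamma_1>0,\ \gamma_2>0,\ \gamma_3>0\}\setminus\{(r,r,r)\in\mathbb{R}^3: r>0\}.$$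
   Formalization: "Bounded by" is read as the topological boundary: as the boundary of S also contains the removed ray {(r,r,r)} and limit points such as (1,1,0), it is stated as the union of the Γ_i plus that ray inside the open octant, and as the closure of that union plus the ray in R^3. *)

theory Defs
  imports "HOL-Analysis.Analysis"
begin

(* Index arithmetic in type 3 is modulo 3, so {i, i + 1, i + 2} = {1, 2, 3}, with 3 = 0;
   see gamma_eq below. *)
definition gamma :: "3 \<Rightarrow> real^3 \<Rightarrow> real" where
  "gamma i x = (x $ (i + 1) - x $ (i + 2))\<^sup>2
     + 2 * x $ i * (x $ (i + 1) + x $ (i + 2)) - 3 * (x $ i)\<^sup>2"

lemma gamma_eq:
  assumes "{i, j, k} = {1, 2, 3 :: 3}"
  shows "gamma i x = (x $ j - x $ k)\<^sup>2 + 2 * x $ i * (x $ j + x $ k) - 3 * (x $ i)\<^sup>2"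
proof -
  have "card {1, 2, 3 :: 3} = 3"
    by simp
  then have "card {i, j, k} = 3"
    using assms by simp
  then have neq: "i \<noteq> j" "i \<noteq> k" "j \<noteq> k"
    by (auto simp: card_insert_if split: if_splits)
  have idx: "(1::3) + 1 = 2" "(1::3) + 2 = 3" "(2::3) + 1 = 3"
      "(2::3) + 2 = 1" "(3::3) + 1 = 1" "(3::3) + 2 = 2"
    by simp_all
  have "j = i + 1 \<and> k = i + 2 \<or> j = i + 2 \<and> k = i + 1"
    using neq exhaust_3[of i] exhaust_3[of j] exhaust_3[of k]
    by (elim disjE; simp only: idx; blast)
  then show ?thesis
    unfolding gamma_def
    by (elim disjE conjE; simp only:) (simp add: power2_commute add.commute)
qed

definition octant :: "(real^3) set" where
  "octant = {x. \<forall>i. 0 < x $ i}"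

definition diag :: "(real^3) set" where
  "diag = {(\<chi> i. r) | r. 0 < r}"

(* Since gamma i > 0 on diag, the deleted ray is part of the topological boundary of S, in
   addition to the surfaces Gamma i. *)
definition S :: "(real^3) set" where
  "S = {x \<in> octant. \<forall>i. 0 < gamma i x} - diag"

definition Gamma :: "3 \<Rightarrow> (real^3) set" where
  "Gamma i = {x \<in> octant. gamma i x = 0}"

(* Regular C^1 surface in three-space: locally the zero set of a continuously
   differentiable function with non-vanishing gradient G. *)
definition surface :: "(real^3) set \<Rightarrow> bool" where
  "surface M \<longleftrightarrow> (\<forall>p\<in>M. \<exists>U g G. open U \<and> p \<in> U
     \<and> (\<forall>x\<in>U. GDERIV g x :> G x) \<and> continuous_on U G \<and> (\<forall>x\<in>U. G x \<noteq> 0)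
     \<and> M \<inter> U = {x \<in> U. g x = (0::real)})"

(* Only strictly positive multiples are required, since the surfaces at hand do not contain
   the apex 0; the library predicate cone would force 0 into the set. *)
definition conic_surface :: "(real^3) set \<Rightarrow> bool" where
  "conic_surface M \<longleftrightarrow> M \<noteq> {} \<and> surface M \<and> (\<forall>x\<in>M. \<forall>c>0. c *\<^sub>R x \<in> M)"

end

theory Submission
  imports Defs
begin

text \<open>
  Positivity of every \<open>gamma i\<close> on the octant persists under adding positive multiples of
  \<open>(1, 1, 1)\<close>, because \<open>gamma i x \<ge> 0\<close> forces the triangle inequality
  \<open>x $ i < x $ (i + 1) + x $ (i + 2)\<close>. Hence every point of \<open>S\<close> can be slid inside \<open>S\<close> along the
  diagonal direction onto a cone over the punctured plane, which is connected; the same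
  translation shows that the surfaces consist of limits of points of \<open>S\<close>. On a face of the octant,
  where say \<open>x $ 3 = 0\<close>, \<open>gamma 1\<close> and \<open>gamma 2\<close> factor and are both non-negative only if
  \<open>x $ 1 = x $ 2\<close>; such points are limits of points of the surfaces.
\<close>

section \<open>Algebra and sign conditions of \<open>gamma\<close>\<close>

lemma index_3_simps:
  "(1::3) + 1 = 2" "(1::3) + 2 = 3" "(2::3) + 1 = 3"
  "(2::3) + 2 = 1" "(3::3) + 1 = 1" "(3::3) + 2 = 2"
  by simp_all

lemma continuous_on_gamma [continuous_intros]: "continuous_on A (gamma i)"
proof -
  have "gamma i = (\<lambda>x. (x $ (i + 1) - x $ (i + 2))\<^sup>2
     + 2 * x $ i * (x $ (i + 1) + x $ (i + 2)) - 3 * (x $ i)\<^sup>2)"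
    by (simp add: gamma_def fun_eq_iff)
  then show ?thesis by (auto intro!: continuous_intros)
qed

text \<open>Expansion along the diagonal: the coefficient of \<open>r\<^sup>2\<close> is the value
  of \<open>gamma i\<close> at (1, 1, 1), and the linear one is twice the slack in the triangle
  inequality.\<close>

lemma gamma_add_vec:
  "gamma i (x + vec r) = gamma i x + 2 * r * (x $ (i + 1) + x $ (i + 2) - x $ i) + r\<^sup>2"
  by (simp add: gamma_def power2_eq_square algebra_simps)

lemma gamma_scaleR: "gamma i (c *\<^sub>R x) = c\<^sup>2 * gamma i x"
  by (simp add: gamma_def power2_eq_square algebra_simps)

text \<open>Otherwise \<open>(b - c)\<^sup>2 < (b + c)\<^sup>2 \<le> a * (b + c) \<le>
  a\<^sup>2\<close>, and the negative term \<open>3 * a\<^sup>2\<close> outweighs the rest.\<close>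

lemma gamma_nonneg_imp_triangle:
  assumes "x \<in> octant" "0 \<le> gamma i x"
  shows "x $ i < x $ (i + 1) + x $ (i + 2)"
proof (rule ccontr)
  define a b c where "a = x $ i" and "b = x $ (i + 1)" and "c = x $ (i + 2)"
  have pos: "a > 0" "b > 0" "c > 0"
    using assms(1) by (auto simp: octant_def a_def b_def c_def)
  assume "\<not> ?thesis"
  then have le: "b + c \<le> a" by (simp add: a_def b_def c_def)
  have "(b - c)\<^sup>2 < (b + c) * (b + c)"
    using mult_pos_pos[OF pos(2,3)] by (simp add: power2_eq_square algebra_simps)
  also have "\<dots> \<le> a * (b + c)"
    using le pos by (intro mult_right_mono) auto
  finally have "(b - c)\<^sup>2 < a * (b + c)" .
  moreover have "a * (b + c) \<le> a * a"
    using le pos by (intro mult_left_mono) auto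
  ultimately have "(b - c)\<^sup>2 + 2 * a * (b + c) - 3 * a\<^sup>2 < 0"
    by (simp add: power2_eq_square)
  with assms(2) show False by (simp add: gamma_def a_def b_def c_def)
qed

lemma gamma_add_vec_pos:
  assumes "x \<in> octant" "0 \<le> gamma i x" "0 < r"
  shows "0 < gamma i (x + vec r)"
proof -
  have "0 < 2 * r * (x $ (i + 1) + x $ (i + 2) - x $ i)"
    using gamma_nonneg_imp_triangle[OF assms(1,2)] assms(3) by simp
  then show ?thesis
    unfolding gamma_add_vec using assms(2) zero_le_power2[of r] by linarith
qed

text \<open>The form is a square plus \<open>4 * (a * (b - a))\<close>; when \<open>a = b\<close>
  the product vanishes, but the square is then \<open>c\<^sup>2\<close>.\<close>

lemma quadratic_pos:
  fixes a b c :: real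
  assumes "0 < a" "0 < c" "a \<le> b"
  shows "0 < (b - c)\<^sup>2 + 2 * a * (b + c) - 3 * a\<^sup>2"
proof -
  have eq: "(b - c)\<^sup>2 + 2 * a * (b + c) - 3 * a\<^sup>2 = (b - a - c)\<^sup>2 + 4 * (a * (b - a))"
    by (simp add: power2_eq_square algebra_simps)
  show ?thesis
  proof (cases "a = b")
    case True
    then show ?thesis unfolding eq using assms by simp
  next
    case False
    then have "0 < a * (b - a)" using assms by simp
    then show ?thesis unfolding eq using zero_le_power2[of "b - a - c"] by linarith
  qed
qed

text \<open>Contrapositive of \<open>quadratic_pos\<close>, applied to each of the other two
  coordinates, in which \<open>gamma i\<close> is symmetric. At a given point at most one index can
  satisfy the hypothesis, whence the disjointness of the surfaces.\<close>

lemma gamma_nonpos_imp_greater: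
  assumes "x \<in> octant" "gamma i x \<le> 0" "j \<noteq> i"
  shows "x $ j < x $ i"
proof -
  have pos: "0 < x $ k" for k using assms(1) by (simp add: octant_def)
  have "x $ (i + 1) < x $ i"
    using quadratic_pos[OF pos[of i] pos[of "i + 2"], of "x $ (i + 1)"] assms(2)
    by (force simp: gamma_def)
  moreover have "x $ (i + 2) < x $ i"
    using quadratic_pos[OF pos[of i] pos[of "i + 1"], of "x $ (i + 2)"] assms(2)
    by (force simp: gamma_def power2_commute add.commute)
  moreover have "j = i + 1 \<or> j = i + 2"
    using assms(3) exhaust_3[of i] exhaust_3[of j] by (elim disjE; simp only: index_3_simps; blast)
  ultimately show ?thesis by blast
qed

section \<open>Membership in \<open>S\<close>\<close>

lemma diag_iff: "x \<in> diag \<longleftrightarrow> x \<in> octant \<and> x $ 1 = x $ 2 \<and> x $ 2 = x $ 3"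
proof
  assume R: "x \<in> octant \<and> x $ 1 = x $ 2 \<and> x $ 2 = x $ 3"
  then have "x = (\<chi> i. x $ 1)" "0 < x $ 1"
    by (auto simp: vec_eq_iff forall_3 octant_def)
  then show "x \<in> diag" unfolding diag_def by blast
qed (auto simp: diag_def octant_def)

lemma S_iff: "x \<in> S \<longleftrightarrow>
    x \<in> octant \<and> (\<forall>i. 0 < gamma i x) \<and> \<not> (x $ 1 = x $ 2 \<and> x $ 2 = x $ 3)"
  by (auto simp: S_def diag_iff)

lemma add_vec_in_S:
  assumes "x \<in> octant" "\<And>i. 0 \<le> gamma i x" "x \<notin> diag" "0 < r"
  shows "x + vec r \<in> S"
  unfolding S_iff using assms gamma_add_vec_pos[OF assms(1,2,4)]
  by (auto simp: octant_def diag_iff add_pos_pos)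

text \<open>After the translation \<open>r\<^sup>2\<close> dominates: the other terms of
  \<open>gamma i\<close> sum to at least \<open>- 6 * r * d - 7 * d\<^sup>2\<close>, which
  \<open>10 * d \<le> r\<close> outweighs.\<close>

lemma near_diag_in_S:
  assumes "\<And>i. \<bar>w $ i\<bar> \<le> d" "0 < r" "10 * d \<le> r" "\<not> (w $ 1 = w $ 2 \<and> w $ 2 = w $ 3)"
  shows "w + vec r \<in> S"
proof -
  have "d > 0"
  proof (rule ccontr)
    assume "\<not> d > 0"
    then have "w $ i = 0" for i using assms(1)[of i] by linarith
    with assms(4) show False by simp
  qed
  have "0 < gamma i (w + vec r)" for i
  proof -
    define a b c where "a = w $ i" and "b = w $ (i + 1)" and "c = w $ (i + 2)"
    have bd: "\<bar>a\<bar> \<le> d" "\<bar>b\<bar> \<le> d" "\<bar>c\<bar> \<le> d"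
      using assms(1) by (simp_all add: a_def b_def c_def)
    have "\<bar>a * (b + c)\<bar> \<le> d * (2 * d)"
      unfolding abs_mult using bd by (intro mult_mono) auto
    moreover have "\<bar>a * a\<bar> \<le> d * d"
      unfolding abs_mult using bd by (intro mult_mono) auto
    moreover have "r * (a - b - c) \<le> r * (3 * d)"
      using bd assms(2) by (intro mult_left_mono) auto
    moreover have "10 * (r * d) \<le> r * r"
      using assms(2,3) by (simp add: mult.left_commute)
    moreover have "10 * (d * d) \<le> r * d"
      using mult_right_mono[OF assms(3), of d] \<open>d > 0\<close> by simp
    moreover have "0 < d * d" using \<open>d > 0\<close> by simp
    ultimately have "0 < (b - c)\<^sup>2 + 2 * (a * (b + c)) - 3 * (a * a) - 2 * (r * (a - b - c)) + r * r"
      using zero_le_power2[of "b - c"] by linarith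
    then show ?thesis
      unfolding gamma_add_vec
      by (simp add: gamma_def a_def b_def c_def power2_eq_square algebra_simps)
  qed
  moreover have "w + vec r \<in> octant"
    unfolding octant_def
  proof safe
    fix i show "0 < (w + vec r) $ i"
      using assms(1)[of i] assms(3) \<open>d > 0\<close> by simp
  qed
  ultimately show ?thesis unfolding S_iff using assms(4) by auto
qed

section \<open>Connectedness of \<open>S\<close>\<close>

lemma add_vec_closed_segment:
  fixes x :: "real^'n"
  assumes "0 \<le> r" "y \<in> closed_segment x (x + vec r)"
  obtains s where "0 \<le> s" "y = x + vec s"
proof -
  obtain u where u: "0 \<le> u" "y = (1 - u) *\<^sub>R x + u *\<^sub>R (x + vec r)"
    using assms(2) by (auto simp: in_segment)
  then have "y = x + vec (u * r)" by (simp add: vec_eq_iff algebra_simps)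
  with u(1) assms(1) show ?thesis by (intro that[of "u * r"]) auto
qed

lemma closed_segment_subset_S:
  assumes "x \<in> S" "0 \<le> r"
  shows "closed_segment x (x + vec r) \<subseteq> S"
proof
  fix y assume "y \<in> closed_segment x (x + vec r)"
  then obtain s where s: "0 \<le> s" "y = x + vec s"
    using add_vec_closed_segment assms(2) by blast
  show "y \<in> S"
  \<comment> \<open>\<open>add_vec_in_S\<close> needs a positive shift, so the starting point is
    treated apart.\<close>
  proof (cases "s = 0")
    case True
    then have "y = x" using s by (simp add: vec_eq_iff)
    then show ?thesis using assms(1) by simp
  next
    case False
    then show ?thesis
      unfolding s(2) using s(1) assms(1) by (intro add_vec_in_S) (auto simp: S_def less_imp_le)
  qed
qed

lemma connected_S: "connected S"
proof -
  \<comment> \<open>\<open>w\<close> embeds the plane transversally to the diagonal. Lifting by ten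
    times the norm meets the hypothesis of \<open>near_diag_in_S\<close>, so that \<open>D\<close>
    is a punctured cone inside \<open>S\<close>.\<close>
  define w :: "real \<times> real \<Rightarrow> real^3" where
    "w v = vector [fst v, snd v, 0]" for v
  define h where "h v = w v + vec (10 * norm v)" for v
  define D where "D = h ` (- {0})"
  have w_nth: "w v $ 1 = fst v" "w v $ 2 = snd v" "w v $ 3 = 0" for v
    by (simp_all add: w_def)
  have w_nondiag: "\<not> (w v $ 1 = w v $ 2 \<and> w v $ 2 = w v $ 3)" if "v \<noteq> 0" for v
    using that by (cases v) (auto simp: w_nth zero_prod_def)
  have h_nth: "h v $ 1 = fst v + 10 * norm v" "h v $ 2 = snd v + 10 * norm v"
    "h v $ 3 = 10 * norm v" for v
    by (simp_all add: h_def w_nth)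
  have "continuous_on (- {0}) (\<lambda>v. h v $ i)" for i
    using exhaust_3[of i] by (elim disjE) (simp_all add: h_nth, (intro continuous_intros)+)
  then have "continuous_on (- {0}) (\<lambda>v. \<chi> i. h v $ i)"
    by (rule continuous_on_vec_lambda)
  then have "continuous_on (- {0}) h" by simp
  moreover have "connected (- {0 :: real \<times> real})"
    by (rule connected_punctured_universe) simp
  ultimately have conD: "connected D"
    unfolding D_def by (rule connected_continuous_image)
  have hS: "h v \<in> S" if "v \<noteq> 0" for v
    unfolding h_def
  proof (rule near_diag_in_S[where d = "norm v"])
    show "\<bar>w v $ i\<bar> \<le> norm v" for i
      using exhaust_3[of i] norm_fst_le[of "fst v" "snd v"] norm_snd_le[of "snd v" "fst v"]
      by (auto simp: w_nth)
  qed (use that w_nondiag in auto)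
  \<comment> \<open>All the sets \<open>C x\<close> contain \<open>D\<close>, so their union is
    connected once each of them is.\<close>
  define C where "C x = D \<union> closed_segment x (h (x $ 1 - x $ 3, x $ 2 - x $ 3))" for x
  have "connected (C x) \<and> C x \<subseteq> S" if "x \<in> S" for x
  proof -
    \<comment> \<open>Subtracting the third coordinate projects \<open>x\<close> along the diagonal,
      so \<open>h v\<close> and \<open>x\<close> lie on a common line of direction (1, 1,
      1).\<close>
    define v where "v = (x $ 1 - x $ 3, x $ 2 - x $ 3)"
    have "v \<noteq> 0" using that by (auto simp: S_iff v_def zero_prod_def)
    define r where "r = 10 * norm v - x $ 3"
    have hx: "h v = x + vec r"
      by (simp add: vec_eq_iff forall_3 h_nth r_def v_def)
    then have xh: "x = h v + vec (- r)" by (simp add: vec_eq_iff)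
    have "closed_segment x (h v) \<subseteq> S"
    \<comment> \<open>Sliding inside \<open>S\<close> is guaranteed only upwards, so the segment is
      started at its lower endpoint.\<close>
    proof (cases "r \<ge> 0")
      case True
      then show ?thesis using closed_segment_subset_S[OF that] by (simp add: hx)
    next
      case False
      then have "closed_segment (h v) (h v + vec (- r)) \<subseteq> S"
        by (intro closed_segment_subset_S hS \<open>v \<noteq> 0\<close>) simp
      then show ?thesis by (simp add: closed_segment_commute flip: xh)
    qed
    moreover have "D \<subseteq> S" using hS by (auto simp: D_def)
    moreover have "h v \<in> D" using \<open>v \<noteq> 0\<close> by (simp add: D_def)
    ultimately show ?thesis
      unfolding C_def v_def[symmetric] by (auto intro!: connected_Un conD)
  qed
  note C = this
  have "S = (\<Union>x\<in>S. C x)"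
    using C by (auto simp: C_def)
  moreover have "h (1, 0) \<in> D" by (auto simp: D_def zero_prod_def)
  then have "h (1, 0) \<in> (\<Inter>x\<in>S. C x)"
    by (auto simp: C_def)
  then have "connected (\<Union>x\<in>S. C x)"
    using C by (intro connected_Union) auto
  ultimately show ?thesis by simp
qed

section \<open>The topological frontier of \<open>S\<close>\<close>

lemma open_octant: "open octant"
  unfolding octant_def forall_3
  by (intro open_Collect_conj open_Collect_less continuous_intros)

lemma open_S: "open S"
proof -
  have "S = octant \<inter> {x. (0 < gamma 1 x \<and> 0 < gamma 2 x \<and> 0 < gamma 3 x) \<and>
      \<not> (x $ 1 = x $ 2 \<and> x $ 2 = x $ 3)}"
    unfolding set_eq_iff S_iff by (simp add: forall_3)
  also have "open \<dots>"
    by (intro open_Int open_octant open_Collect_conj open_Collect_less open_Collect_neg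
        closed_Collect_conj closed_Collect_eq continuous_intros)
  finally show ?thesis .
qed

lemma closure_S_nonneg:
  assumes "x \<in> closure S"
  shows "0 \<le> x $ i" "0 \<le> gamma i x"
proof -
  have "closure S \<subseteq> {x. 0 \<le> x $ i \<and> 0 \<le> gamma i x}"
  proof (rule closure_minimal)
    show "closed {x. 0 \<le> x $ i \<and> 0 \<le> gamma i x}"
      by (intro closed_Collect_conj closed_Collect_le continuous_intros)
  qed (auto simp: S_iff octant_def less_imp_le)
  then show "0 \<le> x $ i" "0 \<le> gamma i x" using assms by auto
qed

lemma add_vec_closure:
  fixes x :: "real^'n"
  assumes "\<And>r. 0 < r \<Longrightarrow> x + vec r \<in> A"
  shows "x \<in> closure A"
proof -
  have "((\<lambda>r. \<chi> i. x $ i + r) \<longlongrightarrow> (\<chi> i. x $ i + 0)) (at_right 0)"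
    by (intro tendsto_intros)
  moreover have "(\<chi> i. x $ i + r) = x + vec r" for r by (simp add: vec_eq_iff)
  ultimately have "((\<lambda>r. x + vec r) \<longlongrightarrow> x) (at_right 0)" by simp
  then show ?thesis
  proof (rule Lim_in_closed_set[rotated -1])
    show "\<forall>\<^sub>F r in at_right 0. x + vec r \<in> closure A"
      using eventually_at_right_less[of 0]
      by (rule eventually_mono) (use assms closure_subset in blast)
  qed auto
qed

text \<open>Coordinate \<open>i\<close> is the strict maximum, so no other \<open>gamma j\<close> is
  negative. Translating upwards then lands in \<open>S\<close>, while \<open>gamma i\<close>
  vanishes at the point itself.\<close>

lemma Gamma_subset_frontier: "Gamma i \<subseteq> frontier S"
proof
  fix x assume x: "x \<in> Gamma i"
  then have oct: "x \<in> octant" and zero: "gamma i x = 0" by (auto simp: Gamma_def)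
  have nonneg: "0 \<le> gamma j x" for j
  proof (rule ccontr)
    assume neg: "\<not> 0 \<le> gamma j x"
    then have "i \<noteq> j" using zero by auto
    then have "x $ i < x $ j" "x $ j < x $ i"
      using gamma_nonpos_imp_greater[OF oct] zero neg by auto
    then show False by simp
  qed
  obtain j where "j \<noteq> i" by (metis one_neq_zero)
  then have "x $ j < x $ i" using gamma_nonpos_imp_greater[OF oct] zero by simp
  then have "x \<notin> diag" by (auto simp: diag_def)
  then have "x \<in> closure S"
    by (intro add_vec_closure add_vec_in_S oct nonneg)
  moreover have "x \<notin> S" using zero by (metis S_iff less_irrefl)
  ultimately show "x \<in> frontier S" by (simp add: frontier_def interior_open open_S)
qed

lemma diag_subset_frontier: "diag \<subseteq> frontier S"
proof
  fix x assume x: "x \<in> diag"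
  then obtain r where r: "x = vec r" "0 < r" by (auto simp: diag_def vec_def)
  have "\<exists>y\<in>S. dist y x < e" if "0 < e" for e
  proof -
    \<comment> \<open>Raising a single coordinate by \<open>d\<close> leaves the ray;
      \<open>r / 10\<close> fits \<open>near_diag_in_S\<close>, and \<open>e / 2\<close> keeps the
      distance below \<open>e\<close>.\<close>
    define d where "d = min (e / 2) (r / 10)"
    have d: "0 < d" "d < e" "10 * d \<le> r" using that r(2) by (auto simp: d_def)
    have "axis 1 d + vec r \<in> S"
      using d r(2) by (intro near_diag_in_S[of _ d]) (auto simp: axis_def)
    moreover have "axis 1 d = d *\<^sub>R (axis 1 1 :: real^3)"
      by (simp add: vec_eq_iff axis_def)
    then have "dist (axis 1 d + vec r) x < e"
      using d by (simp add: r dist_norm)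
    ultimately show ?thesis by blast
  qed
  then have "x \<in> closure S" by (simp add: closure_approachable)
  moreover have "x \<notin> S" using x by (simp add: S_def)
  ultimately show "x \<in> frontier S" by (simp add: frontier_def interior_open open_S)
qed

text \<open>A curve \<open>h e\<close> on the surface tends to \<open>x\<close> as \<open>e\<close>
  decreases to 0: the zero coordinate is raised to \<open>e\<close>, another to
  \<open>a + e\<close>, and the last is solved for. The case \<open>a = 0\<close> covers the
  origin.\<close>

lemma face_in_closure_Gamma:
  assumes "x $ k = 0" "x $ (k + 1) = a" "x $ (k + 2) = a" "0 \<le> a"
  shows "x \<in> closure (Gamma (k + 1))"
proof -
  \<comment> \<open>For \<open>b, c > 0\<close> the unique positive zero of \<open>gamma\<close> in its own coordinate is
    \<open>(b + c + 2 * sqrt (b\<^sup>2 - b * c + c\<^sup>2)) / 3\<close>; here \<open>b = a + e\<close> and \<open>c = e\<close>.\<close>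
  define f where "f e = (a + 2 * e + 2 * sqrt (a\<^sup>2 + a * e + e\<^sup>2)) / 3" for e
  define h :: "real \<Rightarrow> real^3" where
    "h e = (\<chi> j. if j = k then e else if j = k + 1 then f e else a + e)" for e
  have neq: "k + 1 \<noteq> k" "k + 2 \<noteq> k" "k + 2 \<noteq> k + 1"
    using exhaust_3[of k] by (auto simp: index_3_simps)
  have all: "(\<forall>j. P j) \<longleftrightarrow> P k \<and> P (k + 1) \<and> P (k + 2)" for P
    using exhaust_3[of k] by (elim disjE; simp only: index_3_simps forall_3; blast)
  have idx: "k + 1 + 1 = k + 2" "k + 1 + 2 = k"
    using exhaust_3[of k] by (elim disjE; simp only: index_3_simps)+
  have f0: "f 0 = a" using assms(4) by (simp add: f_def)
  have "((\<lambda>e. if j = k then e else if j = k + 1 then f e else a + e) \<longlongrightarrow>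
      (if j = k then 0 else if j = k + 1 then f 0 else a + 0)) (at_right 0)" for j
    unfolding f_def by (auto intro!: tendsto_eq_intros)
  then have "(h \<longlongrightarrow> h 0) (at_right 0)"
    unfolding h_def by (intro tendsto_vec_lambda)
  moreover have "h 0 = x"
    unfolding vec_eq_iff all using assms neq by (simp add: h_def f0)
  ultimately have lim: "(h \<longlongrightarrow> x) (at_right 0)" by simp
  have "h e \<in> Gamma (k + 1)" if "0 < e" for e
  proof -
    define s where "s = sqrt (a\<^sup>2 + a * e + e\<^sup>2)"
    have nn: "0 \<le> a\<^sup>2 + a * e + e\<^sup>2" using that assms(4) by simp
    have s2: "s * s = a\<^sup>2 + a * e + e\<^sup>2" "0 \<le> s" using nn by (simp_all add: s_def)
    have hn: "h e $ k = e" "h e $ (k + 1) = (a + 2 * e + 2 * s) / 3" "h e $ (k + 2) = a + e"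
      using neq by (simp_all add: h_def f_def s_def)
    have "0 < a + 2 * e + 2 * s" using that assms(4) s2(2) by linarith
    then have "h e \<in> octant"
      unfolding octant_def mem_Collect_eq all hn using that assms(4) by auto
    moreover have "gamma (k + 1) (h e) = 0"
    proof -
      \<comment> \<open>Squaring away the root turns the definition of \<open>t\<close> into -3
        times the equation to be shown.\<close>
      define t where "t = (a + 2 * e + 2 * s) / 3"
      have st: "s = (3 * t - a - 2 * e) / 2" by (simp add: t_def field_simps)
      have "(3 * t - a - 2 * e) * (3 * t - a - 2 * e) = 4 * (a\<^sup>2 + a * e + e\<^sup>2)"
        using s2(1) unfolding st by simp
      then have "a\<^sup>2 + 2 * t * (a + 2 * e) - 3 * t\<^sup>2 = 0"
        by (simp add: power2_eq_square algebra_simps)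
      then show ?thesis unfolding gamma_def idx hn t_def[symmetric] by (simp add: algebra_simps)
    qed
    ultimately show ?thesis by (simp add: Gamma_def)
  qed
  then have "\<forall>\<^sub>F e in at_right 0. h e \<in> closure (Gamma (k + 1))"
    using eventually_at_right_less[of 0] closure_subset by (blast intro: eventually_mono)
  then show ?thesis by (intro Lim_in_closed_set[OF closed_closure _ _ lim]) auto
qed

text \<open>With its third coordinate 0 the form factors as
  \<open>(b - a) * (b + 3 * a)\<close>.\<close>

lemma quadratic_face:
  fixes a b :: real
  assumes "0 \<le> a" "0 \<le> b" "0 \<le> b\<^sup>2 + 2 * a * b - 3 * a\<^sup>2"
  shows "a \<le> b"
proof (rule ccontr)
  assume "\<not> a \<le> b"
  then have "0 < (a - b) * (b + 3 * a)" using assms(1,2) by (intro mult_pos_pos) auto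
  with assms(3) show False by (simp add: power2_eq_square algebra_simps)
qed

lemma frontier_S_face:
  assumes "x \<in> frontier S" "x \<notin> octant"
  shows "x \<in> closure (\<Union>i. Gamma i)"
proof -
  have cl: "x \<in> closure S" using assms(1) by (simp add: frontier_def)
  note nonneg = closure_S_nonneg[OF cl]
  obtain k where "\<not> 0 < x $ k" using assms(2) by (auto simp: octant_def)
  with nonneg(1)[of k] have k: "x $ k = 0" by simp
  have idx: "k + 1 + 1 = k + 2" "k + 1 + 2 = k" "k + 2 + 1 = k" "k + 2 + 2 = k + 1"
    using exhaust_3[of k] by (elim disjE; simp only: index_3_simps)+
  \<comment> \<open>The forms with indices \<open>k + 1\<close> and \<open>k + 2\<close> give
    opposite inequalities, forcing the two remaining coordinates to agree.\<close>
  have "x $ (k + 1) \<le> x $ (k + 2)"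
    using nonneg(2)[of "k + 1"] unfolding gamma_def idx k
    by - (rule quadratic_face[OF nonneg(1) nonneg(1)], simp)
  moreover have "x $ (k + 2) \<le> x $ (k + 1)"
    using nonneg(2)[of "k + 2"] unfolding gamma_def idx k
    by - (rule quadratic_face[OF nonneg(1) nonneg(1)], simp)
  ultimately have "x \<in> closure (Gamma (k + 1))"
    by (intro face_in_closure_Gamma[OF k refl _ nonneg(1)]) simp
  then show ?thesis using closure_mono[of "Gamma (k + 1)" "\<Union>i. Gamma i"] by blast
qed

lemma frontier_S_octant: "octant \<inter> frontier S = (\<Union>i. Gamma i) \<union> diag"
proof
  show "octant \<inter> frontier S \<subseteq> (\<Union>i. Gamma i) \<union> diag"
  proof
    fix x assume x: "x \<in> octant \<inter> frontier S"
    then have "x \<in> closure S" "x \<notin> S"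
      by (auto simp: frontier_def interior_open open_S)
    \<comment> \<open>On the closure every \<open>gamma i\<close> is non-negative, so a point of the
      octant outside \<open>S\<close> is on the ray or makes one of them vanish.\<close>
    then have "x \<in> diag \<or> (\<exists>i. gamma i x = 0)"
      using x closure_S_nonneg(2)[of x] by (fastforce simp: S_def order.order_iff_strict)
    then show "x \<in> (\<Union>i. Gamma i) \<union> diag" using x by (auto simp: Gamma_def)
  qed
  show "(\<Union>i. Gamma i) \<union> diag \<subseteq> octant \<inter> frontier S"
    using Gamma_subset_frontier diag_subset_frontier by (auto simp: Gamma_def diag_iff)
qed

text \<open>The surfaces lie in the open octant; their closure supplies the frontier points on its
  faces, including the origin, where the ray ends.\<close>

lemma frontier_S: "frontier S = closure (\<Union>i. Gamma i) \<union> diag"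
proof
  show "frontier S \<subseteq> closure (\<Union>i. Gamma i) \<union> diag"
    using frontier_S_octant frontier_S_face closure_subset[of "\<Union>i. Gamma i"] by blast
  have "closure (\<Union>i. Gamma i) \<subseteq> frontier S"
    using Gamma_subset_frontier by (intro closure_minimal) auto
  then show "closure (\<Union>i. Gamma i) \<union> diag \<subseteq> frontier S"
    using diag_subset_frontier by simp
qed

section \<open>Disjointness, regularity and conicity of the surfaces\<close>

lemma disjoint_Gamma: "disjoint_family Gamma"
  unfolding disjoint_family_on_def
proof safe
  fix i j x assume "i \<noteq> j" "x \<in> Gamma i" "x \<in> Gamma j"
  \<comment> \<open>On each surface the coordinate of its own index is strictly largest, which
    cannot hold for two indices.\<close>
  then have "x $ j < x $ i" "x $ i < x $ j"
    using gamma_nonpos_imp_greater[of x] by (auto simp: Gamma_def)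
  then show "x \<in> {}" by simp
qed

text \<open>The octant serves as neighbourhood of every point, since the gradient of
  \<open>gamma i\<close> vanishes nowhere on it.\<close>

lemma surface_Gamma: "surface (Gamma i)"
  unfolding surface_def
proof
  fix p assume "p \<in> Gamma i"
  define G :: "real^3 \<Rightarrow> real^3" where
    "G x = (2 * (x $ (i + 1) - x $ (i + 2))) *\<^sub>R (axis (i + 1) 1 - axis (i + 2) 1)
      + (2 * (x $ (i + 1) + x $ (i + 2))) *\<^sub>R axis i 1
      + (2 * x $ i) *\<^sub>R (axis (i + 1) 1 + axis (i + 2) 1) - (6 * x $ i) *\<^sub>R axis i 1" for x
  have nth: "((\<lambda>x. x $ j) has_derivative (\<lambda>h. h $ j)) (at x)" for j and x :: "real^3"
    by (rule bounded_linear_imp_has_derivative[OF bounded_linear_vec_nth])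
  have "GDERIV (gamma i) x :> G x" for x
    unfolding gderiv_def gamma_def[abs_def] G_def
    by (rule has_derivative_eq_rhs,
        (rule nth has_derivative_diff has_derivative_add has_derivative_mult has_derivative_power
          has_derivative_const)+)
      (auto simp: fun_eq_iff inner_axis algebra_simps)
  moreover have "continuous_on octant G"
    unfolding G_def[abs_def] by (intro continuous_intros)
  moreover have "G x \<noteq> 0" if "x \<in> octant" for x
  proof -
    have "i + 1 \<noteq> i" "i + 2 \<noteq> i" "i + 2 \<noteq> i + 1"
      using exhaust_3[of i] by (auto simp: index_3_simps)
    \<comment> \<open>In this sum the contributions of the squared difference cancel.\<close>
    then have "G x $ (i + 1) + G x $ (i + 2) = 4 * x $ i"
      by (auto simp: G_def axis_def)
    moreover have "0 < x $ i" using that by (simp add: octant_def)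
    ultimately show ?thesis by auto
  qed
  moreover have "p \<in> octant" "Gamma i \<inter> octant = {x \<in> octant. gamma i x = 0}"
    using \<open>p \<in> Gamma i\<close> by (auto simp: Gamma_def)
  ultimately show "\<exists>U g G. open U \<and> p \<in> U \<and> (\<forall>x\<in>U. GDERIV g x :> G x) \<and> continuous_on U G \<and>
      (\<forall>x\<in>U. G x \<noteq> 0) \<and> Gamma i \<inter> U = {x \<in> U. g x = (0::real)}"
    using open_octant by blast
qed

lemma conic_surface_Gamma: "conic_surface (Gamma i)"
proof -
  have "i + 1 \<noteq> i" "i + 2 \<noteq> i"
    using exhaust_3[of i] by (auto simp: index_3_simps)
  \<comment> \<open>With the other two coordinates equal to 1, \<open>gamma i\<close> becomes
    \<open>4 * t - 3 * t\<^sup>2\<close> in its own coordinate \<open>t\<close>, with positive root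
    4/3.\<close>
  then have "(\<chi> j. if j = i then 4 / 3 else 1) \<in> Gamma i"
    by (simp add: Gamma_def octant_def gamma_def power2_eq_square)
  moreover have "c *\<^sub>R x \<in> Gamma i" if "x \<in> Gamma i" "0 < c" for x c
    using that by (simp add: Gamma_def octant_def gamma_scaleR)
  ultimately show ?thesis
    unfolding conic_surface_def using surface_Gamma by auto
qed

theorem lemma1:
  shows "connected S
    \<and> octant \<inter> frontier S = (\<Union>i. Gamma i) \<union> diag
    \<and> frontier S = closure (\<Union>i. Gamma i) \<union> diag
    \<and> disjoint_family Gamma
    \<and> (\<forall>i. conic_surface (Gamma i))"
  using connected_S frontier_S_octant frontier_S disjoint_Gamma conic_surface_Gamma by blast

end
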